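(* Let $K\subset\mathcal{E}$ be a closed convex cone with nonempty interior and $K\ne\mathcal{E}$. Then, for $\lambda\in\mathbb{R}$, $K$ is outer $\lambda$-smoothable if and only if $\lambda\ge\frac{w_K}{1+w_K}$. In particular, for any target smoothness level $\beta>0$, a $\beta$-smooth closed convex set $S\subseteq\mathcal{E}$ is an optimal outer $\beta$-smoothing of $K$ if and only if $[s^{\mathrm{out}}_K]_{1/\beta}\subseteq S\subseteq[S^{\mathrm{out}}_K]_{1/\beta}$.
   Context: $\mathcal{E}$ is a finite-dimensional Euclidean space with inner product $\langle\cdot,\cdot\rangle$ and induced norm $\|\cdot\|$; $B(x,r)=\{y:\|x-y\|\le r\}$; sums of sets are Minkowski sums; all sets considered are nonempty. A convex cone is a set $K$ with $tx\in K$ for $x\in K$, $t\ge0$, and $x+y\in K$ for $x,y\in K$. For $\eta>0$, $[C]_\eta=\eta C=\{\eta x:x\in C\}$. Hausdorff distance: $\mathrm{dist}(x,C)=\inf_{y\in C}\|x-y\|$, $\mathrm{d}(\tilde C;C)=\sup_{x\in\tilde C}\mathrm{dist}(x,C)$, $\mathrm{dist}(\tilde C,C)=\max\{\mathrm{d}(\tilde C;C),\mathrm{d}(C;\tilde C)\}$ (possibly $+\infty$). Normal cone: $N_C(x)=\{\zeta:\langle\zeta,y-x\rangle\le0\ \forall y\in C\}$ for $x\in C$. A closed convex set $C$ is $\beta$-smooth if $\|\zeta-\zeta'\|\le\beta\|x-x'\|$ for all $x,x'\in C$ and all unit-norm $\zeta\in N_C(x)$, $\zeta'\in N_C(x')$.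 Outer smoothability: $K$ is outer $\lambda$-smoothable if for every $\beta>0$ there is a $\beta$-smooth closed convex set $S\supseteq K$ with $\mathrm{dist}(S,K)\le\lambda/\beta$. A closed convex set $S$ is an optimal outer $\beta$-smoothing of $K$ if $S$ is $\beta$-smooth, $S\supseteq K$, and $\mathrm{dist}(K,S)\le\mathrm{dist}(K,\tilde S)$ for all $\beta$-smooth closed convex $\tilde S\supseteq K$. Core, center, width: $C_K=\{x\in\mathcal{E}:x+B(0,1)\subseteq K\}$; $x_K$ is the (unique) minimum-norm element of $C_K$; $w_K=\|x_K\|-1$. Extremal smoothings: $s^{\mathrm{out}}_K=\frac{1}{1+w_K}\big[(x_K+K)+B(0,1+w_K)\big]$ and $S^{\mathrm{out}}_K=\frac{1}{1+w_K}\big[C_K+B(0,1+w_K)\big]$. *)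

theory Defs
  imports "HOL-Analysis.Analysis"
begin

text \<open>Hausdorff distances take the value \<open>\<infinity>\<close> on unbounded sets, hence the type \<^typ>\<open>ereal\<close>;
  a real-valued supremum would be unspecified there.
  These definitions are meant for nonempty sets only: \<^const>\<open>infdist\<close> to the empty set is 0.\<close>

definition hausdorff_excess :: "'a::metric_space set \<Rightarrow> 'a set \<Rightarrow> ereal" where
  "hausdorff_excess A C = (SUP x\<in>A. ereal (infdist x C))"

definition hausdorff_dist :: "'a::metric_space set \<Rightarrow> 'a set \<Rightarrow> ereal" where
  "hausdorff_dist A C = max (hausdorff_excess A C) (hausdorff_excess C A)"

text \<open>Meaningful for \<open>x \<in> C\<close>.\<close>
definition normal_cone :: "'a::real_inner set \<Rightarrow> 'a \<Rightarrow> 'a set" where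
  "normal_cone C x = {\<zeta>. \<forall>y\<in>C. \<zeta> \<bullet> (y - x) \<le> 0}"

definition smooth_set :: "real \<Rightarrow> 'a::real_inner set \<Rightarrow> bool" where
  "smooth_set \<beta> C \<longleftrightarrow> C \<noteq> {} \<and> closed C \<and> convex C \<and>
     (\<forall>x\<in>C. \<forall>x'\<in>C. \<forall>\<zeta>\<in>normal_cone C x. \<forall>\<zeta>'\<in>normal_cone C x'.
        norm \<zeta> = 1 \<longrightarrow> norm \<zeta>' = 1 \<longrightarrow> norm (\<zeta> - \<zeta>') \<le> \<beta> * norm (x - x'))"

definition outer_smoothable :: "real \<Rightarrow> 'a::real_inner set \<Rightarrow> bool" where
  "outer_smoothable l K \<longleftrightarrow>
     (\<forall>\<beta>>0. \<exists>S. smooth_set \<beta> S \<and> K \<subseteq> S \<and> hausdorff_dist S K \<le> ereal (l / \<beta>))"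

definition optimal_outer_smoothing :: "real \<Rightarrow> 'a::real_inner set \<Rightarrow> 'a set \<Rightarrow> bool" where
  "optimal_outer_smoothing \<beta> K S \<longleftrightarrow> smooth_set \<beta> S \<and> K \<subseteq> S \<and>
     (\<forall>T. smooth_set \<beta> T \<and> K \<subseteq> T \<longrightarrow> hausdorff_dist K S \<le> hausdorff_dist K T)"

definition cone_core :: "'a::real_normed_vector set \<Rightarrow> 'a set" where
  "cone_core K = {x. {x} + cball 0 1 \<subseteq> K}"

text \<open>Existence and uniqueness are shown in \<open>cone_center_unique\<close> below.\<close>
definition cone_center :: "'a::real_normed_vector set \<Rightarrow> 'a" where
  "cone_center K = (THE x. x \<in> cone_core K \<and> (\<forall>y\<in>cone_core K. norm x \<le> norm y))"

definition cone_width :: "'a::real_normed_vector set \<Rightarrow> real" where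
  "cone_width K = norm (cone_center K) - 1"

definition scale_set :: "real \<Rightarrow> 'a::real_vector set \<Rightarrow> 'a set" where
  "scale_set \<eta> C = (\<lambda>x. \<eta> *\<^sub>R x) ` C"

definition min_outer_smoothing :: "'a::real_normed_vector set \<Rightarrow> 'a set" where
  "min_outer_smoothing K =
     scale_set (1 / (1 + cone_width K)) (({cone_center K} + K) + cball 0 (1 + cone_width K))"

definition max_outer_smoothing :: "'a::real_normed_vector set \<Rightarrow> 'a set" where
  "max_outer_smoothing K =
     scale_set (1 / (1 + cone_width K)) (cone_core K + cball 0 (1 + cone_width K))"

lemma cone_core_eq_INT: "cone_core K = (\<Inter>u\<in>cball 0 1. (\<lambda>x. x - u) ` K)"
proof -
  have "x \<in> (\<lambda>x. x - u) ` K \<longleftrightarrow> x + u \<in> K" for x u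
    by (auto simp: image_iff algebra_simps intro: bexI[of _ "x + u"])
  then show ?thesis
    by (fastforce simp: cone_core_def set_plus_def)
qed

lemma cone_center_unique:
  fixes K :: "'a::euclidean_space set"
  assumes K: "convex_cone K" "closed K" "interior K \<noteq> {}"
  shows "\<exists>!x. x \<in> cone_core K \<and> (\<forall>y\<in>cone_core K. norm x \<le> norm y)"
proof -
  have cl: "closed (cone_core K)" unfolding cone_core_eq_INT
    using closed_translation_subtract[OF K(2)] by blast
  have co: "convex (cone_core K)" unfolding cone_core_eq_INT
    using K(1) by (auto simp: convex_cone_def intro!: convex_INT convex_translation_subtract)
  obtain p e where e: "e > 0" "cball p e \<subseteq> K"
    using K(3) by (auto simp: mem_interior_cball)
  have "(1/e) *\<^sub>R p + u \<in> K" if "norm u \<le> 1" for u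
  proof -
    have "p + e *\<^sub>R u \<in> K"
      using e that by (intro subsetD[OF e(2)]) (simp add: dist_norm mult_left_le)
    then have "(1/e) *\<^sub>R (p + e *\<^sub>R u) \<in> K"
      using e(1) K(1) by (intro convex_cone_scaleR) auto
    then show ?thesis using e(1) by (simp add: scaleR_add_right)
  qed
  then have "(1/e) *\<^sub>R p \<in> cone_core K" by (auto simp: cone_core_def set_plus_def)
  then have ne: "cone_core K \<noteq> {}" by blast
  show ?thesis
  proof (rule ex1I[of _ "closest_point (cone_core K) 0"])
    show "closest_point (cone_core K) 0 \<in> cone_core K \<and>
      (\<forall>y\<in>cone_core K. norm (closest_point (cone_core K) 0) \<le> norm y)"
      using closest_point_exists[OF cl ne, of 0] by simp
  next
    fix x assume "x \<in> cone_core K \<and> (\<forall>y\<in>cone_core K. norm x \<le> norm y)"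
    then show "x = closest_point (cone_core K) 0"
      by (intro closest_point_unique[OF co cl]) auto
  qed
qed

end

theory Submission
  imports Defs
begin

text \<open>
  Write \<open>r = 1 / \<beta>\<close> and \<open>\<rho> = norm (cone_center K) = 1 + cone_width K\<close>, so that the critical distance
  \<open>(1 / \<beta>) * w / (1 + w)\<close> is \<open>r - r / \<rho>\<close>.

  The geometric input is that smoothness is a statement about inscribed balls. A \<open>\<beta>\<close>-smooth set is
  a union of balls of radius \<open>r\<close> contained in it (\<open>smooth_set_covered_by_balls\<close>, a consequence of
  Blaschke's rolling theorem \<open>smooth_set_rolling_ball\<close>), and conversely every set \<open>C + cball 0 r\<close>
  with \<open>C\<close> closed and convex is \<open>\<beta>\<close>-smooth (\<open>smooth_set_parallel\<close>).

  Let \<open>S\<close> be a \<open>\<beta>\<close>-smooth superset of \<open>K\<close> whose points all have distance at most \<open>d\<close> from \<open>K\<close>.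
  A ball of radius \<open>r\<close> inside \<open>S\<close> lies in \<open>K + cball 0 d\<close>, and cancelling \<open>cball 0 d\<close> leaves the
  concentric ball of radius \<open>r - d\<close> inside \<open>K\<close> (\<open>inner_ball_of_near_set\<close>). Apply this to a ball of
  radius \<open>r\<close> in \<open>S\<close> that contains the apex \<open>0\<close>: its center has norm at most \<open>r\<close>, whereas by
  homogeneity of \<open>K\<close> the center of any ball of radius \<open>r - d\<close> in \<open>K\<close> has norm at least
  \<open>(r - d) * \<rho>\<close>. Hence \<open>(r - d) * \<rho> \<le> r\<close>, which is the lower bound \<open>d \<ge> r - r / \<rho>\<close>.

  If \<open>d = r - r / \<rho>\<close>, both estimates are equalities. Uniqueness of the minimum-norm point of the core
  then forces the ball around the apex to be centered at \<open>(r / \<rho>) *\<^sub>R cone_center K\<close>; since \<open>K\<close>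
  consists of recession directions of \<open>S\<close>, the whole of the scaled minimal smoothing lies in \<open>S\<close>.
  Applied to the other balls covering \<open>S\<close>, the cancellation puts their centers into
  \<open>(r / \<rho>)\<close> times the core, so \<open>S\<close> lies in the scaled maximal smoothing. Conversely any
  set between the two extremal ones is within \<open>r - r / \<rho>\<close> of \<open>K\<close>, and the minimal one is itself
  smooth, so the bound is attained.
\<close>

section \<open>Smooth convex sets and rolling balls\<close>

lemma frontier_unit_normal:
  fixes S :: "'a::euclidean_space set"
  assumes "convex S" "closed S" "y \<in> frontier S"
  obtains u where "u \<in> normal_cone S y" "norm u = 1"
proof -
  have yS: "y \<in> S" and yi: "y \<notin> interior S"
    using assms(2,3) by (auto simp: frontier_def)
  obtain a where a: "a \<noteq> 0" "\<And>z. z \<in> S \<Longrightarrow> a \<bullet> y \<le> a \<bullet> z"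
  proof (cases "interior S = {}")
    case True
    then obtain a b where "a \<noteq> 0" "S \<subseteq> {x. a \<bullet> x = b}"
      using empty_interior_subset_hyperplane[OF assms(1)] by blast
    then have "a \<bullet> y \<le> a \<bullet> z" if "z \<in> S" for z
      using yS that by (metis (mono_tags, lifting) mem_Collect_eq order_refl subsetD)
    with \<open>a \<noteq> 0\<close> show ?thesis using that by blast
  next
    case False
    then have "y \<notin> rel_interior S"
      using yi rel_interior_nonempty_interior by blast
    then show ?thesis
      using supporting_hyperplane_relative_frontier[OF assms(1), of y] yS assms(2) that
      by (metis closure_closed)
  qed
  show ?thesis
  proof
    show "(- inverse (norm a)) *\<^sub>R a \<in> normal_cone S y"
      using a by (simp add: normal_cone_def inner_diff_right mult_left_mono)
    show "norm ((- inverse (norm a)) *\<^sub>R a) = 1" using a(1) by simp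
  qed
qed

text \<open>The contact point \<open>y = c + \<delta> *\<^sub>R u\<close> is the boundary point of \<open>S\<close> nearest to \<open>c\<close>, with outer normal
  \<open>u\<close>. The number \<open>\<delta>\<close> is the signed distance from \<open>c\<close> to the boundary, negative when \<open>c\<close> lies
  outside \<open>S\<close>; with this sign convention a single formula serves both positions of \<open>c\<close>.\<close>

lemma contact_of_protruding_ball:
  fixes S :: "'a::euclidean_space set"
  assumes S: "convex S" "closed S" "S \<noteq> {}" and out: "\<not> cball c r \<subseteq> S"
  obtains u \<delta> where "c + \<delta> *\<^sub>R u \<in> S" "u \<in> normal_cone S (c + \<delta> *\<^sub>R u)" "norm u = 1" "\<delta> < r"
proof (cases "c \<in> S")
  case False
  define y where "y = closest_point S c"
  have yS: "y \<in> S" unfolding y_def by (rule closest_point_in_set[OF S(2,3)])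
  then have ne: "c \<noteq> y" using False by auto
  have eq: "c + (- norm (c - y)) *\<^sub>R ((c - y) /\<^sub>R norm (c - y)) = y"
    using ne by simp
  have "(c - y) /\<^sub>R norm (c - y) \<in> normal_cone S y"
    using closest_point_dot[OF S(1,2), of _ c, folded y_def]
    by (simp add: normal_cone_def mult_nonneg_nonpos)
  moreover have "r \<ge> 0"
  proof (rule ccontr)
    assume "\<not> r \<ge> 0"
    then show False using out by simp
  qed
  then have "- norm (c - y) < r" using ne by (smt (verit) zero_less_norm_iff right_minus_eq)
  moreover have "norm ((c - y) /\<^sub>R norm (c - y)) = 1" using ne by simp
  ultimately show ?thesis
    using that[of "- norm (c - y)" "(c - y) /\<^sub>R norm (c - y)"] yS unfolding eq by blast
next
  case True
  have "frontier S \<noteq> {}"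
    using out True by (auto simp: frontier_eq_empty)
  define y where "y = closest_point (frontier S) c"
  define \<delta> where "\<delta> = dist c y"
  have yF: "y \<in> frontier S"
    unfolding y_def by (rule closest_point_in_set) (use \<open>frontier S \<noteq> {}\<close> in auto)
  have yS: "y \<in> S" using yF S(2) frontier_subset_closed by blast
  \<comment> \<open>The open ball that just reaches the frontier is connected and misses it, so it stays inside \<open>S\<close>.\<close>
  have ball: "cball c \<delta> \<subseteq> S"
  proof (cases "\<delta> = 0")
    case True
    then show ?thesis using \<open>c \<in> S\<close> by simp
  next
    case False
    then have pos: "\<delta> > 0" by (simp add: \<delta>_def)
    have "ball c \<delta> \<inter> frontier S = {}"
      using closest_point_le[OF frontier_closed, of _ S c]
      unfolding disjoint_iff mem_ball \<delta>_def y_def by (meson leD)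
    moreover have "ball c \<delta> \<inter> S \<noteq> {}" using True pos by force
    ultimately have "ball c \<delta> \<subseteq> S"
      using connected_Int_frontier[of "ball c \<delta>" S] by auto
    then have "closure (ball c \<delta>) \<subseteq> S" using S(2) by (rule closure_minimal)
    then show ?thesis using pos by simp
  qed
  then have "\<delta> < r" using out subset_cball[of r \<delta> c] by (meson leI order_trans)
  obtain u where u: "u \<in> normal_cone S y" "norm u = 1"
    using frontier_unit_normal[OF S(1,2) yF] .
  \<comment> \<open>The inscribed ball lies on the inner side of the hyperplane supporting \<open>S\<close> at \<open>y\<close>, and \<open>y\<close> is at
    distance \<open>\<delta>\<close> from \<open>c\<close>; by the equality case of Cauchy-Schwarz \<open>y - c\<close> points along \<open>u\<close>.\<close>
  have "c + \<delta> *\<^sub>R u \<in> S"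
    using ball u(2) by (auto simp: dist_norm \<delta>_def)
  then have "u \<bullet> (c + \<delta> *\<^sub>R u - y) \<le> 0" using u(1) by (auto simp: normal_cone_def)
  then have le: "\<delta> \<le> u \<bullet> (y - c)"
    using u(2) by (simp add: inner_diff_right inner_add_right dot_square_norm)
  have nyc: "norm (y - c) = \<delta>" by (simp add: \<delta>_def dist_norm norm_minus_commute)
  have "(norm (y - c - \<delta> *\<^sub>R u))\<^sup>2 = \<delta>\<^sup>2 - 2 * \<delta> * (u \<bullet> (y - c)) + \<delta>\<^sup>2"
  proof -
    have "u \<bullet> u = 1" using u(2) by (simp add: norm_eq_1)
    moreover have "(y - c) \<bullet> (y - c) = \<delta>\<^sup>2"
      by (simp only: nyc flip: power2_norm_eq_inner)
    ultimately show ?thesis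
      unfolding power2_norm_eq_inner inner_diff_left[of "y - c"] inner_diff_right[of _ "y - c"]
        inner_commute[of "y - c" "\<delta> *\<^sub>R u"]
      by (simp add: power2_eq_square)
  qed
  also have "\<dots> \<le> 0"
    using mult_left_mono[OF le, of \<delta>] by (simp add: \<delta>_def power2_eq_square)
  finally have "y - c - \<delta> *\<^sub>R u = 0" by simp
  then have "y = c + \<delta> *\<^sub>R u" by (metis diff_diff_eq right_minus_eq)
  then show ?thesis using that[of \<delta> u] yS u \<open>\<delta> < r\<close> by blast
qed

text \<open>Blaschke's rolling theorem. Suppose the ball with center \<open>c = x - r *\<^sub>R z\<close> protrudes, and compare \<open>x\<close> with
  the contact point \<open>y = c + \<delta> *\<^sub>R u\<close>. With \<open>k = u \<bullet> z\<close>, squaring the Lipschitz bound for the normals at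
  \<open>x\<close> and \<open>y\<close> gives \<open>r\<^sup>2 (2 - 2k) \<le> (r - \<delta>)\<^sup>2 + r \<delta> (2 - 2k)\<close>, that is \<open>r (2 - 2k) \<le> r - \<delta>\<close>.
  Since \<open>x\<close> lies on the inner side of the supporting hyperplane at \<open>y\<close>, also \<open>r k \<le> \<delta>\<close>. Together
  these give \<open>2 (r - \<delta>) \<le> r - \<delta>\<close>, contradicting \<open>\<delta> < r\<close>.\<close>

lemma smooth_set_rolling_ball:
  fixes S :: "'a::euclidean_space set"
  assumes sm: "smooth_set (1 / r) S" and r: "r > 0"
    and x: "x \<in> S" and z: "z \<in> normal_cone S x" "norm z = 1"
  shows "cball (x - r *\<^sub>R z) r \<subseteq> S"
proof (rule ccontr)
  assume "\<not> ?thesis"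
  then obtain u \<delta> where y: "x - r *\<^sub>R z + \<delta> *\<^sub>R u \<in> S"
      "u \<in> normal_cone S (x - r *\<^sub>R z + \<delta> *\<^sub>R u)" and u: "norm u = 1" and "\<delta> < r"
    using contact_of_protruding_ball sm unfolding smooth_set_def by metis
  define k where "k = u \<bullet> z"
  have uu: "u \<bullet> u = 1" and zz: "z \<bullet> z = 1" using u z(2) by (auto simp: norm_eq_1)
  have "norm (u - z) \<le> 1 / r * norm (x - r *\<^sub>R z + \<delta> *\<^sub>R u - x)"
    using sm x y z u unfolding smooth_set_def by blast
  also have "x - r *\<^sub>R z + \<delta> *\<^sub>R u - x = \<delta> *\<^sub>R u - r *\<^sub>R z" by simp
  finally have "norm (u - z) \<le> 1 / r * norm (\<delta> *\<^sub>R u - r *\<^sub>R z)" .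
  then have "r * norm (u - z) \<le> norm (\<delta> *\<^sub>R u - r *\<^sub>R z)"
    using r by (simp add: field_simps)
  then have "r\<^sup>2 * (norm (u - z))\<^sup>2 \<le> (norm (\<delta> *\<^sub>R u - r *\<^sub>R z))\<^sup>2"
    using r by (metis less_imp_le mult_nonneg_nonneg norm_ge_zero power_mono power_mult_distrib)
  moreover have "(norm (u - z))\<^sup>2 = 2 - 2 * k"
    by (simp add: power2_norm_eq_inner inner_diff_left inner_diff_right uu zz k_def inner_commute)
  moreover have "(norm (\<delta> *\<^sub>R u - r *\<^sub>R z))\<^sup>2 = \<delta>\<^sup>2 + r\<^sup>2 - 2 * \<delta> * r * k"
    unfolding power2_norm_eq_inner
    by (simp add: inner_diff_left inner_diff_right uu zz k_def inner_commute power2_eq_square)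
  ultimately have "r\<^sup>2 * (2 - 2 * k) \<le> \<delta>\<^sup>2 + r\<^sup>2 - 2 * \<delta> * r * k"
    by (simp only:)
  then have "(r - \<delta>) * (r * (2 - 2 * k)) \<le> (r - \<delta>) * (r - \<delta>)"
    by (simp add: power2_eq_square algebra_simps)
  then have "r * (2 - 2 * k) \<le> r - \<delta>"
    using \<open>\<delta> < r\<close> by (simp add: mult_le_cancel_left)
  moreover have "r * k \<le> \<delta>"
    using y(2) x by (auto simp: normal_cone_def inner_diff_right inner_add_right uu k_def)
  ultimately show False using \<open>\<delta> < r\<close> by (simp add: algebra_simps)
qed

text \<open>A point at depth at least \<open>r\<close> is the center of its own ball; a point closer to the boundary lies on the
  inner normal at its nearest boundary point and is covered by the ball that rolls there.\<close>

lemma smooth_set_covered_by_balls: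
  fixes S :: "'a::euclidean_space set"
  assumes sm: "smooth_set (1 / r) S" and r: "r > 0" and z: "z \<in> S"
  obtains c where "cball c r \<subseteq> S" "z \<in> cball c r"
proof (cases "cball z r \<subseteq> S")
  case True
  then show ?thesis using that[of z] r by simp
next
  case False
  then obtain u \<delta> where y: "z + \<delta> *\<^sub>R u \<in> S"
      "u \<in> normal_cone S (z + \<delta> *\<^sub>R u)" and u: "norm u = 1" and "\<delta> < r"
    using contact_of_protruding_ball sm unfolding smooth_set_def by metis
  have "\<delta> \<ge> 0"
    using y(2) z u by (auto simp: normal_cone_def norm_eq_1)
  then have "z \<in> cball (z + \<delta> *\<^sub>R u - r *\<^sub>R u) r"
    using u \<open>\<delta> < r\<close> by (simp add: dist_norm flip: scaleR_diff_left)
  then show ?thesis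
    using that smooth_set_rolling_ball[OF sm r y u] by blast
qed

lemma closed_set_plus_compact:
  fixes C :: "'a::real_normed_vector set"
  assumes "closed C" "compact D"
  shows "closed (C + D)"
proof -
  have "C + D = (\<Union>x\<in>C. \<Union>y\<in>D. {x + y})" by (auto simp: set_plus_def)
  then show ?thesis using closed_compact_sums[OF assms] by simp
qed

text \<open>Write \<open>x = p + v\<close>. As \<open>p + r *\<^sub>R z\<close> also belongs to the parallel set, maximality of \<open>x\<close> in direction \<open>z\<close>
  yields \<open>z \<bullet> v \<ge> r\<close>, and a vector of norm at most \<open>r\<close> achieves this only if it equals \<open>r *\<^sub>R z\<close>.\<close>

lemma unit_normal_of_parallel_set:
  fixes C :: "'a::real_inner set"
  assumes r: "r > 0" and x: "x \<in> C + cball 0 r"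
    and z: "z \<in> normal_cone (C + cball 0 r) x" "norm z = 1"
  obtains p where "p \<in> C" "x = p + r *\<^sub>R z" "z \<in> normal_cone C p"
proof -
  obtain p v where p: "p \<in> C" and v: "norm v \<le> r" and xpv: "x = p + v"
    using x by (auto simp: set_plus_def)
  have le: "z \<bullet> (q + r *\<^sub>R z - x) \<le> 0" if "q \<in> C" for q
  proof -
    have "q + r *\<^sub>R z \<in> C + cball 0 r" using that z(2) r by (intro set_plus_intro) auto
    then show ?thesis using z(1) by (simp add: normal_cone_def)
  qed
  have zz: "z \<bullet> z = 1" using z(2) by (simp add: norm_eq_1)
  have "r \<le> z \<bullet> v" using le[OF p] zz by (simp add: xpv inner_diff_right)
  moreover have "v \<bullet> v \<le> r * r"
    using v r by (metis mult_mono norm_ge_zero power2_eq_square power2_norm_eq_inner less_imp_le)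
  moreover have "(v - r *\<^sub>R z) \<bullet> (v - r *\<^sub>R z) = v \<bullet> v - 2 * (r * (z \<bullet> v)) + r * r"
    by (simp add: inner_diff_left inner_diff_right zz inner_commute)
  ultimately have "(v - r *\<^sub>R z) \<bullet> (v - r *\<^sub>R z) \<le> 0"
    using r mult_left_mono[of r "z \<bullet> v" r] by linarith
  then have "(v - r *\<^sub>R z) \<bullet> (v - r *\<^sub>R z) = 0"
    using inner_ge_zero[of "v - r *\<^sub>R z"] by linarith
  then have "v = r *\<^sub>R z" by (simp only: inner_eq_zero_iff right_minus_eq)
  then show ?thesis
    using that[of p] p le xpv by (auto simp: normal_cone_def algebra_simps)
qed

text \<open>Two points with unit normals \<open>z\<close> and \<open>z'\<close> have the form \<open>x = p + r *\<^sub>R z\<close> and \<open>x' = p' + r *\<^sub>R z'\<close>,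
  where \<open>z\<close> and \<open>z'\<close> are normal to \<open>C\<close> at \<open>p\<close> and \<open>p'\<close>. So \<open>x - x' = (p - p') + r *\<^sub>R (z - z')\<close>.
  Monotonicity of the normal cone map makes the inner product of \<open>z - z'\<close> with the first summand
  nonnegative, so \<open>r (norm (z - z'))\<^sup>2 \<le> (z - z') \<bullet> (x - x')\<close>, and Cauchy-Schwarz
  finishes.\<close>

lemma smooth_set_parallel:
  fixes C :: "'a::euclidean_space set"
  assumes C: "closed C" "convex C" "C \<noteq> {}" and r: "r > 0"
  shows "smooth_set (1 / r) (C + cball 0 r)"
  unfolding smooth_set_def
proof (intro conjI ballI impI)
  show "C + cball 0 r \<noteq> {}" using C(3) r
    by (simp add: set_plus_def ex_in_conv[symmetric]) (metis less_imp_le mem_cball_0 norm_zero)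
  show "closed (C + cball 0 r)" by (simp add: C closed_set_plus_compact)
  show "convex (C + cball 0 r)" by (simp add: C convex_set_plus)
  fix x x' z z'
  assume "x \<in> C + cball 0 r" "x' \<in> C + cball 0 r" "z \<in> normal_cone (C + cball 0 r) x"
    "z' \<in> normal_cone (C + cball 0 r) x'" "norm z = 1" "norm z' = 1"
  then obtain p p' where p: "p \<in> C" "x = p + r *\<^sub>R z" "z \<in> normal_cone C p"
    and p': "p' \<in> C" "x' = p' + r *\<^sub>R z'" "z' \<in> normal_cone C p'"
    using unit_normal_of_parallel_set[OF r] by metis
  have "z \<bullet> (p' - p) \<le> 0" "z' \<bullet> (p - p') \<le> 0"
    using p p' by (auto simp: normal_cone_def)
  then have mono: "(z - z') \<bullet> (p - p') \<ge> 0"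
    by (simp add: inner_diff_left inner_diff_right)
  have "r * (norm (z - z'))\<^sup>2 \<le> (z - z') \<bullet> (p - p') + r * ((z - z') \<bullet> (z - z'))"
    using mono by (simp add: power2_norm_eq_inner)
  also have "\<dots> = (z - z') \<bullet> (x - x')"
    by (simp add: p p' inner_diff_right inner_add_right algebra_simps)
  also have "\<dots> \<le> norm (z - z') * norm (x - x')" by (rule norm_cauchy_schwarz)
  finally have "norm (z - z') * (r * norm (z - z')) \<le> norm (z - z') * norm (x - x')"
    by (simp add: power2_eq_square ac_simps)
  then have "r * norm (z - z') \<le> norm (x - x')"
    by (cases "z = z'") (auto simp: mult_le_cancel_left)
  then show "norm (z - z') \<le> 1 / r * norm (x - x')"
    using r by (simp add: field_simps)
qed

section \<open>Cancelling balls and recession directions\<close>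

text \<open>A form of the cancellation law for Minkowski sums of convex sets. A point \<open>z\<close> of the smaller ball outside
  \<open>K\<close> could be moved a further distance \<open>d\<close> away from \<open>K\<close>, along the direction \<open>v\<close> from its projection,
  without leaving the larger ball; this would produce a point of \<open>S\<close> at distance more than
  \<open>d\<close> from \<open>K\<close>.\<close>

lemma inner_ball_of_near_set:
  fixes K :: "'a::euclidean_space set"
  assumes K: "convex K" "closed K" "K \<noteq> {}"
    and near: "\<And>x. x \<in> S \<Longrightarrow> infdist x K \<le> d" and "d \<ge> 0" and cS: "cball c r \<subseteq> S"
  shows "cball c (r - d) \<subseteq> K"
proof (rule subsetI, rule ccontr)
  fix z assume z: "z \<in> cball c (r - d)" "z \<notin> K"
  define p where "p = closest_point K z"
  define v where "v = (z - p) /\<^sub>R norm (z - p)"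
  have pK: "p \<in> K" unfolding p_def by (rule closest_point_in_set[OF K(2,3)])
  then have ne: "norm (z - p) > 0" using z(2) by auto
  have v1: "norm v = 1" using ne by (simp add: v_def)
  have "norm (c - (z + d *\<^sub>R v)) \<le> norm (c - z) + norm (d *\<^sub>R v)"
    by (metis diff_diff_eq norm_triangle_ineq4)
  then have "z + d *\<^sub>R v \<in> cball c r"
    using z(1) v1 \<open>d \<ge> 0\<close> by (simp add: dist_norm)
  then have "infdist (z + d *\<^sub>R v) K \<le> d" using near cS by blast
  then obtain k where k: "k \<in> K" "norm (z + d *\<^sub>R v - k) \<le> d"
    using infdist_attains_inf[OF K(2,3)] by (metis dist_norm)
  have "v \<bullet> (k - p) \<le> 0"
    using closest_point_dot[OF K(1,2) k(1), of z] ne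
    by (simp add: v_def p_def mult_nonneg_nonpos)
  moreover have "v \<bullet> (z + d *\<^sub>R v - k) \<le> d"
    using norm_cauchy_schwarz[of v "z + d *\<^sub>R v - k"] v1 k(2) by simp
  moreover have "v \<bullet> (z - p) = norm (z - p)"
    using ne by (simp add: v_def dot_square_norm power2_eq_square)
  moreover have "v \<bullet> v = 1" using v1 by (simp add: norm_eq_1)
  ultimately show False
    using ne by (simp add: inner_diff_right inner_add_right)
qed

text \<open>A cone inside a closed convex set consists of recession directions: \<open>x + k\<close> is the limit of the convex
  combinations of \<open>x\<close> and the far-away points \<open>n *\<^sub>R k\<close> with weight \<open>1 / n\<close> on the latter.\<close>

lemma convex_plus_contained_cone:
  fixes S K :: "'a::real_normed_vector set"
  assumes S: "convex S" "closed S" and K: "convex_cone K" "K \<subseteq> S"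
    and x: "x \<in> S" and k: "k \<in> K"
  shows "x + k \<in> S"
proof -
  have "(1 - inverse (real (Suc n))) *\<^sub>R x + k \<in> S" for n
  proof -
    have "real (Suc n) *\<^sub>R k \<in> S"
      using convex_cone_scaleR[OF K(1), of "real (Suc n)" k] k K(2) by auto
    then have "(1 - inverse (real (Suc n))) *\<^sub>R x
        + inverse (real (Suc n)) *\<^sub>R (real (Suc n) *\<^sub>R k) \<in> S"
      by (intro convexD[OF S(1) x]) (auto simp: field_simps)
    then show ?thesis by simp
  qed
  moreover have "(\<lambda>n. (1 - inverse (real (Suc n))) *\<^sub>R x + k) \<longlonglongrightarrow> (1 - 0) *\<^sub>R x + k"
    by (intro tendsto_intros LIMSEQ_inverse_real_of_nat)
  ultimately show ?thesis
    using closed_sequentially[OF S(2)] by fastforce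
qed

text \<open>For a superset the excess of \<open>K\<close> over \<open>S\<close> vanishes, so only the distances from points of \<open>S\<close> to
  \<open>K\<close> matter.\<close>

lemma hausdorff_dist_superset_le_iff:
  assumes "K \<subseteq> S" "K \<noteq> {}" "d \<ge> 0"
  shows "hausdorff_dist S K \<le> ereal d \<longleftrightarrow> (\<forall>x\<in>S. infdist x K \<le> d)"
proof -
  have "hausdorff_excess K S = 0"
    using assms(1,2) by (auto simp: hausdorff_excess_def subset_iff zero_ereal_def)
  then show ?thesis
    using assms(3) by (auto simp: hausdorff_dist_def hausdorff_excess_def SUP_le_iff)
qed

section \<open>Core and center of a cone\<close>

lemma singleton_plus_cball:
  fixes c :: "'a::real_normed_vector"
  shows "{c} + cball 0 t = cball c t"
proof (intro set_eqI iffI)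
  fix x assume "x \<in> cball c t"
  then have "c + (x - c) \<in> {c} + cball 0 t"
    by (intro set_plus_intro) (auto simp: dist_norm norm_minus_commute)
  then show "x \<in> {c} + cball 0 t" by simp
qed (auto simp: set_plus_def dist_norm)

lemma cball_subset_cone_scaleR:
  fixes K :: "'a::real_normed_vector set"
  assumes K: "convex_cone K" and t: "t > 0"
  shows "cball (t *\<^sub>R c) (t * s) \<subseteq> K \<longleftrightarrow> cball c s \<subseteq> K"
proof -
  have "t *\<^sub>R y \<in> K \<longleftrightarrow> y \<in> K" for y
    using convex_cone_scaleR[OF K, of t y] convex_cone_scaleR[OF K, of "inverse t" "t *\<^sub>R y"] t
    by auto
  moreover have "cball (t *\<^sub>R c) (t * s) = (*\<^sub>R) t ` cball c s"
    using cball_scale[of t c s] t by simp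
  ultimately show ?thesis by auto
qed

text \<open>By homogeneity the extremal property of \<^term>\<open>cone_center K\<close>, which concerns unit balls, holds
  for inscribed balls of every radius \<open>t\<close>: among their centers, \<open>t *\<^sub>R cone_center K\<close> is the only one
  of least norm.\<close>

lemma
  fixes K :: "'a::euclidean_space set"
  assumes K: "convex_cone K" "closed K" "interior K \<noteq> {}"
  shows cball_cone_center: "t > 0 \<Longrightarrow> cball (t *\<^sub>R cone_center K) t \<subseteq> K"
    and norm_cone_center_le: "t > 0 \<Longrightarrow> cball c t \<subseteq> K \<Longrightarrow> t * norm (cone_center K) \<le> norm c"
    and eq_scaled_cone_center:
      "t > 0 \<Longrightarrow> cball c t \<subseteq> K \<Longrightarrow> norm c \<le> t * norm (cone_center K) \<Longrightarrow> c = t *\<^sub>R cone_center K"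
proof -
  have core: "x \<in> cone_core K \<longleftrightarrow> cball x 1 \<subseteq> K" for x
    by (simp add: cone_core_def singleton_plus_cball)
  note ex1 = cone_center_unique[OF K]
  have cen: "cball (cone_center K) 1 \<subseteq> K" "\<And>y. cball y 1 \<subseteq> K \<Longrightarrow> norm (cone_center K) \<le> norm y"
    using theI'[OF ex1, folded cone_center_def] by (simp_all add: core)
  then show "t > 0 \<Longrightarrow> cball (t *\<^sub>R cone_center K) t \<subseteq> K"
    using cball_subset_cone_scaleR[OF K(1), of t _ 1] by simp
  have sc: "cball (c /\<^sub>R t) 1 \<subseteq> K" if "t > 0" "cball c t \<subseteq> K"
    using cball_subset_cone_scaleR[OF K(1), of t "c /\<^sub>R t" 1] that by simp
  show "t > 0 \<Longrightarrow> cball c t \<subseteq> K \<Longrightarrow> t * norm (cone_center K) \<le> norm c"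
    using cen(2)[OF sc] by (simp add: field_simps)
  assume t: "t > 0" "cball c t \<subseteq> K" "norm c \<le> t * norm (cone_center K)"
  then have "norm (c /\<^sub>R t) \<le> norm (cone_center K)" by (simp add: field_simps)
  then have "c /\<^sub>R t \<in> cone_core K \<and> (\<forall>y\<in>cone_core K. norm (c /\<^sub>R t) \<le> norm y)"
    using sc[OF t(1,2)] cen(2) unfolding core by (meson order.trans core)
  then have "c /\<^sub>R t = cone_center K"
    unfolding cone_center_def by (rule the1_equality[OF ex1, symmetric])
  then have "t *\<^sub>R (c /\<^sub>R t) = t *\<^sub>R cone_center K" by (rule arg_cong)
  then show "c = t *\<^sub>R cone_center K" using t(1) by simp
qed

text \<open>If the center had norm below \<open>1\<close>, its unit ball would contain a neighbourhood of the apex, and a cone with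
  the apex in its interior is the whole space. In particular the width is nonnegative.\<close>

lemma norm_cone_center_ge_1:
  fixes K :: "'a::euclidean_space set"
  assumes K: "convex_cone K" "closed K" "interior K \<noteq> {}" and "K \<noteq> UNIV"
  shows "norm (cone_center K) \<ge> 1"
proof (rule ccontr)
  define e where "e = 1 - norm (cone_center K)"
  assume "\<not> ?thesis"
  then have e: "e > 0" by (simp add: e_def)
  have "cball 0 e \<subseteq> cball (1 *\<^sub>R cone_center K) 1"
    by (simp add: cball_subset_cball_iff e_def dist_norm)
  then have eK: "cball 0 e \<subseteq> K" using cball_cone_center[OF K, of 1] by simp
  have "x \<in> K" for x
  proof (cases "x = 0")
    case False
    have "(e / norm x) *\<^sub>R x \<in> K"
      using e False by (intro subsetD[OF eK]) simp
    then have "(norm x / e) *\<^sub>R ((e / norm x) *\<^sub>R x) \<in> K"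
      using e by (auto intro!: convex_cone_scaleR[OF K(1), of "norm x / e"] simp del: scaleR_scaleR)
    then show ?thesis using e False by simp
  qed (use convex_cone_contains_0[OF K(1)] in simp)
  then show False using \<open>K \<noteq> UNIV\<close> by blast
qed

section \<open>The two extremal smoothings at an arbitrary scale\<close>

lemma scale_set_set_plus: "scale_set t (A + B) = scale_set t A + scale_set t B"
  by (fastforce simp: scale_set_def set_plus_def scaleR_add_right image_iff)

lemma scale_set_scale_set: "scale_set s (scale_set t A) = scale_set (s * t) A"
  by (simp add: scale_set_def image_image)

lemma scale_set_cball_0:
  fixes s t :: real
  assumes "t > 0"
  shows "scale_set t (cball (0::'a::real_normed_vector) s) = cball 0 (t * s)"
  using cball_scale[of t 0 s] assms by (simp add: scale_set_def)

lemma scale_set_convex_cone: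
  fixes K :: "'a::real_vector set"
  assumes "convex_cone K" "t > 0"
  shows "scale_set t K = K"
proof
  show "scale_set t K \<subseteq> K"
    using assms convex_cone_scaleR[of K t] by (auto simp: scale_set_def)
  show "K \<subseteq> scale_set t K"
  proof
    fix x assume "x \<in> K"
    then have "inverse t *\<^sub>R x \<in> K" using assms by (intro convex_cone_scaleR) auto
    then show "x \<in> scale_set t K"
      using assms(2) unfolding scale_set_def by (intro image_eqI[of _ _ "inverse t *\<^sub>R x"]) auto
  qed
qed

lemma scale_set_cone_core:
  fixes K :: "'a::real_normed_vector set"
  assumes "convex_cone K" "t > 0"
  shows "scale_set t (cone_core K) = {c. cball c t \<subseteq> K}"
proof -
  have "cball c t \<subseteq> K \<longleftrightarrow> c /\<^sub>R t \<in> cone_core K" for c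
    using cball_subset_cone_scaleR[OF assms, of "c /\<^sub>R t" 1] assms(2)
    by (simp add: cone_core_def singleton_plus_cball)
  then show ?thesis
    using assms(2) by (force simp: scale_set_def image_iff intro: bexI[of _ "_ /\<^sub>R t"])
qed

text \<open>Distributing the scaling factors turns both extremal sets into parallel sets at distance exactly \<open>r\<close>,
  the form to which the results on rolling balls apply; the cone absorbs its own factor, and the
  scaled core is the set of centers of inscribed balls of radius \<open>t\<close>.\<close>

lemma
  fixes K :: "'a::real_normed_vector set"
  assumes K: "convex_cone K" and r: "r > 0" and "norm (cone_center K) > 0"
  defines "t \<equiv> r / norm (cone_center K)"
  shows scale_min_outer_smoothing:
      "scale_set r (min_outer_smoothing K) = ({t *\<^sub>R cone_center K} + K) + cball 0 r"
    and scale_max_outer_smoothing: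
      "scale_set r (max_outer_smoothing K) = {c. cball c t \<subseteq> K} + cball 0 r"
proof -
  have t: "t > 0" using assms by simp
  have tr: "t * norm (cone_center K) = r" using assms by simp
  have *: "scale_set t (cball 0 (norm (cone_center K))) = cball (0::'a) r"
    using scale_set_cball_0[OF t] tr by metis
  have **: "r * (1 / (1 + cone_width K)) = t" "1 + cone_width K = norm (cone_center K)"
    by (simp_all add: cone_width_def t_def)
  have "scale_set t {cone_center K} = {t *\<^sub>R cone_center K}" by (simp add: scale_set_def)
  then show "scale_set r (min_outer_smoothing K) = ({t *\<^sub>R cone_center K} + K) + cball 0 r"
    unfolding min_outer_smoothing_def scale_set_scale_set **(1) unfolding **(2)
    by (simp add: scale_set_set_plus scale_set_convex_cone[OF K t] *)
  show "scale_set r (max_outer_smoothing K) = {c. cball c t \<subseteq> K} + cball 0 r"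
    unfolding max_outer_smoothing_def scale_set_scale_set **(1) unfolding **(2)
    by (simp add: scale_set_set_plus scale_set_cone_core[OF K t] *)
qed

section \<open>Sharp bound and the sets attaining it\<close>

text \<open>The ball produced here is one that covers the apex; this is what bounds the norm of its center. It is the
  source of both the lower bound and the minimal smoothing.\<close>

lemma inner_ball_of_near_smooth_superset:
  fixes K :: "'a::euclidean_space set"
  assumes K: "convex_cone K" "closed K" "interior K \<noteq> {}"
    and sm: "smooth_set (1 / r) S" and r: "r > 0" and KS: "K \<subseteq> S"
    and near: "\<And>x. x \<in> S \<Longrightarrow> infdist x K \<le> d" and d: "d \<ge> 0"
  obtains c where "cball c r \<subseteq> S" "norm c \<le> r" "cball c (r - d) \<subseteq> K"
proof -
  have "0 \<in> S" using KS convex_cone_contains_0[OF K(1)] by auto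
  then obtain c where c: "cball c r \<subseteq> S" "0 \<in> cball c r"
    using smooth_set_covered_by_balls[OF sm r] by blast
  have "convex K" "K \<noteq> {}" using K(1) by (simp_all add: convex_cone_def)
  from this(1) K(2) this(2) near d c(1) have "cball c (r - d) \<subseteq> K"
    by (rule inner_ball_of_near_set)
  moreover have "norm c \<le> r" using c(2) by simp
  ultimately show ?thesis using that c(1) by blast
qed

lemma near_smooth_superset_lower_bound:
  fixes K :: "'a::euclidean_space set"
  assumes K: "convex_cone K" "closed K" "interior K \<noteq> {}" "K \<noteq> UNIV"
    and sm: "smooth_set (1 / r) S" and r: "r > 0" and KS: "K \<subseteq> S"
    and near: "\<And>x. x \<in> S \<Longrightarrow> infdist x K \<le> d" and d: "d \<ge> 0"
  shows "r - r / norm (cone_center K) \<le> d"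
proof (cases "d < r")
  case True
  obtain c where "cball c r \<subseteq> S" and c: "norm c \<le> r" "cball c (r - d) \<subseteq> K"
    using K(1-3) sm r KS near d by (rule inner_ball_of_near_smooth_superset)
  have "(r - d) * norm (cone_center K) \<le> norm c"
    using True by (intro norm_cone_center_le[OF K(1-3) _ c(2)]) simp
  then have "(r - d) * norm (cone_center K) \<le> r" using c(1) by linarith
  moreover have "norm (cone_center K) > 0"
    using norm_cone_center_ge_1[OF K] by linarith
  ultimately have "r - d \<le> r / norm (cone_center K)" by (simp add: pos_le_divide_eq)
  then show ?thesis by linarith
next
  case False
  moreover have "r / norm (cone_center K) \<ge> 0" using r by simp
  ultimately show ?thesis by linarith
qed

text \<open>The Hausdorff distance may be infinite, so the bound is derived by contradiction from a real number
  strictly between the distance and the claimed bound.\<close>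

lemma hausdorff_dist_smooth_superset_ge:
  fixes K :: "'a::euclidean_space set"
  assumes K: "convex_cone K" "closed K" "interior K \<noteq> {}" "K \<noteq> UNIV"
    and sm: "smooth_set (1 / r) S" and r: "r > 0" and KS: "K \<subseteq> S"
  shows "ereal (r - r / norm (cone_center K)) \<le> hausdorff_dist S K"
proof (rule ccontr)
  assume "\<not> ?thesis"
  then have "hausdorff_dist S K < ereal (r - r / norm (cone_center K))" by (simp only: not_le)
  then obtain d where d: "hausdorff_dist S K < ereal d" "ereal d < ereal (r - r / norm (cone_center K))"
    using ereal_dense2 by blast
  have K0: "K \<noteq> {}" using K(1) convex_cone_nonempty by blast
  then obtain k where "k \<in> K" by blast
  then have "0 \<le> hausdorff_excess K S"
    unfolding hausdorff_excess_def by (rule SUP_upper2) (simp add: infdist_nonneg)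
  then have "0 < ereal d" using d(1) unfolding hausdorff_dist_def
    by (rule le_less_trans[OF max.coboundedI2])
  then have d0: "d \<ge> 0" by simp
  have near: "infdist x K \<le> d" if "x \<in> S" for x
    using hausdorff_dist_superset_le_iff[OF KS K0 d0] d(1) that by (simp add: less_imp_le)
  from K sm r KS near d0 have "r - r / norm (cone_center K) \<le> d"
    by (rule near_smooth_superset_lower_bound)
  then show False using d(2) by simp
qed

text \<open>The core of the argument. From left to right: the covering ball at the apex has its center of norm at most
  \<open>r = t * \<rho>\<close>, while its concentric ball of radius \<open>t = r / \<rho>\<close> lies in \<open>K\<close>, so its center is
  \<open>t *\<^sub>R cone_center K\<close>; all other covering balls shrink to balls of radius \<open>t\<close> in \<open>K\<close>. From right
  to left: the apex lies on the boundary of the ball around \<open>t *\<^sub>R cone_center K\<close>, which gives \<open>K \<subseteq> S\<close>,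
  and a point \<open>c + v\<close> of the maximal set is moved into \<open>K\<close> by shrinking \<open>v\<close> by the factor
  \<open>t / r\<close>.\<close>

lemma near_smooth_superset_iff_between:
  fixes K :: "'a::euclidean_space set"
  assumes K: "convex_cone K" "closed K" "interior K \<noteq> {}" "K \<noteq> UNIV"
    and sm: "smooth_set (1 / r) S" and r: "r > 0"
  shows "K \<subseteq> S \<and> (\<forall>x\<in>S. infdist x K \<le> r - r / norm (cone_center K)) \<longleftrightarrow>
    scale_set r (min_outer_smoothing K) \<subseteq> S \<and> S \<subseteq> scale_set r (max_outer_smoothing K)"
proof -
  define \<rho> where "\<rho> = norm (cone_center K)"
  define t where "t = r / \<rho>"
  have \<rho>: "\<rho> \<ge> 1" unfolding \<rho>_def by (rule norm_cone_center_ge_1[OF K])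
  have t: "t > 0" "t \<le> r" "t * \<rho> = r"
    using \<rho> r by (simp_all add: t_def field_simps)
  have Kc: "convex K" "K \<noteq> {}" using K(1) by (auto simp: convex_cone_def)
  have S: "convex S" "closed S" using sm by (auto simp: smooth_set_def)
  have min: "scale_set r (min_outer_smoothing K) = ({t *\<^sub>R cone_center K} + K) + cball 0 r"
    and max: "scale_set r (max_outer_smoothing K) = {c. cball c t \<subseteq> K} + cball 0 r"
    using scale_min_outer_smoothing[OF K(1) r] scale_max_outer_smoothing[OF K(1) r] \<rho>
    unfolding \<rho>_def t_def by (simp_all only: order.strict_trans2[OF zero_less_one])
  have min': "({t *\<^sub>R cone_center K} + K) + cball 0 r = cball (t *\<^sub>R cone_center K) r + K"
    unfolding singleton_plus_cball[of "t *\<^sub>R cone_center K" r, symmetric] by (simp only: ac_simps)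
  show ?thesis unfolding \<rho>_def[symmetric] t_def[symmetric] min max min'
  proof (intro iffI conjI; elim conjE)
    assume KS: "K \<subseteq> S" and near: "\<forall>x\<in>S. infdist x K \<le> r - t"
    have near': "infdist x K \<le> r - t" if "x \<in> S" for x using near that by blast
    obtain c where c: "cball c r \<subseteq> S" "norm c \<le> r" "cball c t \<subseteq> K"
      using inner_ball_of_near_smooth_superset[OF K(1-3) sm r KS near'] t(2) by auto
    have "c = t *\<^sub>R cone_center K"
      using eq_scaled_cone_center[OF K(1-3) t(1) c(3)] c(2) t(3) by (simp add: \<rho>_def)
    then have "cball (t *\<^sub>R cone_center K) r \<subseteq> S" using c(1) by simp
    then show "cball (t *\<^sub>R cone_center K) r + K \<subseteq> S"
      using convex_plus_contained_cone[OF S K(1) KS] by (auto elim!: set_plus_elim)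
    show "S \<subseteq> {c. cball c t \<subseteq> K} + cball 0 r"
    proof
      fix x assume "x \<in> S"
      then obtain c where c: "cball c r \<subseteq> S" "x \<in> cball c r"
        using smooth_set_covered_by_balls[OF sm r] by blast
      have "cball c t \<subseteq> K"
        using inner_ball_of_near_set[OF Kc(1) K(2) Kc(2) near' _ c(1)] t(2) by simp
      then have "c + (x - c) \<in> {c. cball c t \<subseteq> K} + cball 0 r"
        using c(2) by (intro set_plus_intro) (auto simp: dist_norm norm_minus_commute)
      then show "x \<in> {c. cball c t \<subseteq> K} + cball 0 r" by simp
    qed
  next
    assume lo: "cball (t *\<^sub>R cone_center K) r + K \<subseteq> S"
    have "0 \<in> cball (t *\<^sub>R cone_center K) r"
      using t by (simp add: \<rho>_def[symmetric])
    then have "0 + k \<in> cball (t *\<^sub>R cone_center K) r + K" if "k \<in> K" for k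
      using that by (rule set_plus_intro)
    then show "K \<subseteq> S" using lo by auto
  next
    assume hi: "S \<subseteq> {c. cball c t \<subseteq> K} + cball 0 r"
    show "\<forall>x\<in>S. infdist x K \<le> r - t"
    proof
      fix x assume "x \<in> S"
      then obtain c v where c: "cball c t \<subseteq> K" and v: "norm v \<le> r" and x: "x = c + v"
        using hi by (auto simp: subset_iff set_plus_def)
      have "c + (t / r) *\<^sub>R v \<in> K"
        using v t r by (intro subsetD[OF c]) (simp add: dist_norm field_simps mult_left_mono)
      moreover have "dist x (c + (t / r) *\<^sub>R v) \<le> r - t"
      proof -
        have "x - (c + (t / r) *\<^sub>R v) = (1 - t / r) *\<^sub>R v" by (simp add: x algebra_simps)
        then have "dist x (c + (t / r) *\<^sub>R v) = (1 - t / r) * norm v"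
          using t r by (simp add: dist_norm)
        also have "\<dots> \<le> (1 - t / r) * r"
          using v t r by (intro mult_left_mono) auto
        finally show ?thesis using r by (simp add: algebra_simps)
      qed
      ultimately show "infdist x K \<le> r - t" by (rule infdist_le2)
    qed
  qed
qed

lemma sharp_smooth_superset_iff_between:
  fixes K :: "'a::euclidean_space set"
  assumes K: "convex_cone K" "closed K" "interior K \<noteq> {}" "K \<noteq> UNIV"
    and sm: "smooth_set (1 / r) S" and r: "r > 0"
  shows "K \<subseteq> S \<and> hausdorff_dist S K \<le> ereal (r - r / norm (cone_center K)) \<longleftrightarrow>
    scale_set r (min_outer_smoothing K) \<subseteq> S \<and> S \<subseteq> scale_set r (max_outer_smoothing K)"
proof -
  have "r - r / norm (cone_center K) \<ge> 0"
    using norm_cone_center_ge_1[OF K] r frac_le[of r r 1 "norm (cone_center K)"] by simp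
  then show ?thesis
    using near_smooth_superset_iff_between[OF assms]
      hausdorff_dist_superset_le_iff[OF _ convex_cone_nonempty[OF K(1)]] by metis
qed

lemma smooth_set_scaled_min_outer_smoothing:
  fixes K :: "'a::euclidean_space set"
  assumes K: "convex_cone K" "closed K" "interior K \<noteq> {}" "K \<noteq> UNIV" and r: "r > 0"
  shows "smooth_set (1 / r) (scale_set r (min_outer_smoothing K))"
proof -
  have pos: "norm (cone_center K) > 0"
    using norm_cone_center_ge_1[OF K] by linarith
  have "closed ({x} + K)" "convex ({x} + K)" "{x} + K \<noteq> {}" for x
    using K(1,2) closed_set_plus_compact[of K "{x}"]
    by (auto simp: convex_cone_def add.commute intro!: convex_set_plus)
  then show ?thesis
    unfolding scale_min_outer_smoothing[OF K(1) r pos] by (intro smooth_set_parallel r)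
qed

text \<open>Translating an inscribed ball by an element of \<open>K\<close> keeps it inscribed, so every point of
  \<open>t *\<^sub>R cone_center K + K\<close> is the center of an inscribed ball of radius \<open>t\<close>. This makes the minimal smoothing one of
  the sets that attain the bound.\<close>

lemma scaled_min_outer_smoothing_between:
  fixes K :: "'a::euclidean_space set"
  assumes K: "convex_cone K" "closed K" "interior K \<noteq> {}" "K \<noteq> UNIV" and r: "r > 0"
  shows "scale_set r (min_outer_smoothing K) \<subseteq> scale_set r (max_outer_smoothing K)"
proof -
  define t where "t = r / norm (cone_center K)"
  have pos: "norm (cone_center K) > 0"
    using norm_cone_center_ge_1[OF K] by linarith
  then have t: "t > 0" using r by (simp add: t_def)
  have "{t *\<^sub>R cone_center K} + K \<subseteq> {c. cball c t \<subseteq> K}"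
  proof (clarsimp elim!: set_plus_elim)
    fix k y assume k: "k \<in> K" "dist (t *\<^sub>R cone_center K + k) y \<le> t"
    then have "y - k \<in> cball (t *\<^sub>R cone_center K) t"
      by (simp add: dist_norm algebra_simps)
    then have "y - k \<in> K" using cball_cone_center[OF K(1-3) t] by blast
    then show "y \<in> K" using convex_cone_add[OF K(1), of "y - k" k] k(1) by simp
  qed
  then show ?thesis
    unfolding scale_min_outer_smoothing[OF K(1) r pos] scale_max_outer_smoothing[OF K(1) r pos]
    unfolding t_def by (rule set_plus_mono2) simp
qed

theorem theorem4p6:
  fixes K :: "'a::euclidean_space set"
  assumes "convex_cone K" and "closed K" and "interior K \<noteq> {}" and "K \<noteq> UNIV"
  shows "(\<forall>l::real. outer_smoothable l K \<longleftrightarrow> l \<ge> cone_width K / (1 + cone_width K)) \<and>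
    (\<forall>\<beta>>0. \<forall>S. smooth_set \<beta> S \<longrightarrow>
      (optimal_outer_smoothing \<beta> K S \<longleftrightarrow>
        scale_set (1 / \<beta>) (min_outer_smoothing K) \<subseteq> S \<and>
        S \<subseteq> scale_set (1 / \<beta>) (max_outer_smoothing K)))"
proof -
  define \<rho> where "\<rho> = norm (cone_center K)"
  have \<rho>: "\<rho> \<ge> 1" unfolding \<rho>_def by (rule norm_cone_center_ge_1[OF assms])
  have width: "cone_width K / (1 + cone_width K) = 1 - 1 / \<rho>"
    using \<rho> by (simp add: cone_width_def \<rho>_def[symmetric] field_simps)
  \<comment> \<open>the least possible Hausdorff distance at smoothness level \<open>\<beta>\<close>\<close>
  define D where "D \<beta> = ereal (1 / \<beta> - 1 / \<beta> / \<rho>)" for \<beta>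
  have lower: "D \<beta> \<le> hausdorff_dist T K" if "\<beta> > 0" "smooth_set \<beta> T" "K \<subseteq> T" for \<beta> T
    using hausdorff_dist_smooth_superset_ge[OF assms, of "1 / \<beta>" T] that
    by (simp add: D_def \<rho>_def)
  have sharp: "K \<subseteq> T \<and> hausdorff_dist T K \<le> D \<beta> \<longleftrightarrow>
      scale_set (1 / \<beta>) (min_outer_smoothing K) \<subseteq> T \<and>
      T \<subseteq> scale_set (1 / \<beta>) (max_outer_smoothing K)"
    if "\<beta> > 0" "smooth_set \<beta> T" for \<beta> T
    using sharp_smooth_superset_iff_between[OF assms, of "1 / \<beta>" T] that
    by (simp add: D_def \<rho>_def)
  have attained: "\<exists>T. smooth_set \<beta> T \<and> K \<subseteq> T \<and> hausdorff_dist T K \<le> D \<beta>" if "\<beta> > 0" for \<beta>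
  proof -
    have "smooth_set \<beta> (scale_set (1 / \<beta>) (min_outer_smoothing K))"
      using smooth_set_scaled_min_outer_smoothing[OF assms, of "1 / \<beta>"] that by simp
    moreover have "scale_set (1 / \<beta>) (min_outer_smoothing K)
        \<subseteq> scale_set (1 / \<beta>) (max_outer_smoothing K)"
      using scaled_min_outer_smoothing_between[OF assms, of "1 / \<beta>"] that by simp
    ultimately show ?thesis using sharp[OF that] by blast
  qed
  have commute: "hausdorff_dist K T = hausdorff_dist T K" for T
    by (simp add: hausdorff_dist_def max.commute)
  have "outer_smoothable l K \<longleftrightarrow> l \<ge> 1 - 1 / \<rho>" for l
  proof
    assume "outer_smoothable l K"
    then obtain T where "smooth_set 1 T" "K \<subseteq> T" "hausdorff_dist T K \<le> ereal l"
      unfolding outer_smoothable_def by (metis div_by_1 zero_less_one)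
    then have "D 1 \<le> ereal l" using lower[of 1 T] by simp
    then show "l \<ge> 1 - 1 / \<rho>" by (simp add: D_def)
  next
    assume "l \<ge> 1 - 1 / \<rho>"
    then have "D \<beta> \<le> ereal (l / \<beta>)" if "\<beta> > 0" for \<beta>
      using divide_right_mono[of "1 - 1 / \<rho>" l \<beta>] that by (simp add: D_def diff_divide_distrib mult.commute)
    then show "outer_smoothable l K"
      using attained unfolding outer_smoothable_def by (meson order_trans)
  qed
  moreover have "optimal_outer_smoothing \<beta> K S \<longleftrightarrow> K \<subseteq> S \<and> hausdorff_dist S K \<le> D \<beta>"
    if "\<beta> > 0" "smooth_set \<beta> S" for \<beta> S
    unfolding optimal_outer_smoothing_def commute
    using that lower[OF that(1)] attained[OF that(1)] by (meson order_trans)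
  ultimately show ?thesis unfolding width using sharp by simp
qed

end
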